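(* Fix integers $N>1$, $a\ge 1$, $b\ge 1$ and consider the system of $N$ interacting urns with parameter $\alpha$ described in the context. Suppose $0<\alpha<1/2$ and let $j\in\{1,\dots,N\}$. Then there is a real random variable $\widetilde D$ (depending on $j$) with $P(\widetilde D\neq 0)>0$ such that $$\widetilde D_t(j):=t^{\alpha}\,(Z_t(j)-Z_t)\longrightarrow \widetilde D\qquad\text{as } t\to+\infty,$$ both almost surely and in $L^1$.
   Context: Model. On a probability space $(\Omega,\mathcal A,P)$ there are $N$ urns. At time $t=0$ each urn contains $a$ red balls and $b$ black balls; set $m=a+b$. At each time $t+1$ ($t\ge 0$) one new ball is added to each urn. Let $I_{t+1}(i)\in\{0,1\}$ be the indicator that the ball added to urn $i$ at time $t+1$ is red, let $Z_t(i)$ be the proportion of red balls in urn $i$ at time $t$, and let $Z_t=\frac1N\sum_{i=1}^N Z_t(i)$. Thus $Z_0(i)=a/m$ and $Z_{t+1}(i)-Z_t(i)=\frac{I_{t+1}(i)-Z_t(i)}{m+t+1}$. Let $\mathcal F_0=\{\Omega,\emptyset\}$ and $\mathcal F_t=\sigma(I_k(i):\ i=1,\dots,N,\ 1\le k\le t)$. Conditionally on $\mathcal F_t$, the variables $I_{t+1}(1),\dots,I_{t+1}(N)$ are independent and $P(I_{t+1}(j)=1\mid\mathcal F_t)=\alpha Z_t+(1-\alpha)Z_t(j)$, where $\alpha\in[0,1]$ is a parameter. *)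

theory Defs
  imports "HOL-Probability.Probability"
begin

definition cond_prob_subalg :: "'a measure \<Rightarrow> 'a measure \<Rightarrow> 'a set \<Rightarrow> 'a \<Rightarrow> real" where
  "cond_prob_subalg M F A = real_cond_exp M F (indicat_real A)"

text \<open>Independence of a family of random variables conditionally on the sub-sigma-algebra \<open>F\<close>;
  the conditional counterpart of \<open>prob_space.indep_vars\<close>.\<close>

definition cond_indep_vars ::
    "'a measure \<Rightarrow> 'a measure \<Rightarrow> ('i \<Rightarrow> 'b measure) \<Rightarrow> ('i \<Rightarrow> 'a \<Rightarrow> 'b) \<Rightarrow> 'i set \<Rightarrow> bool" where
  "cond_indep_vars M F M' X I \<longleftrightarrow>
     (\<forall>i\<in>I. X i \<in> measurable M (M' i)) \<and>
     (\<forall>J\<subseteq>I. J \<noteq> {} \<longrightarrow> finite J \<longrightarrow> (\<forall>A\<in>(\<Pi> j\<in>J. sets (M' j)).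
        AE \<omega> in M. cond_prob_subalg M F (\<Inter>j\<in>J. X j -` A j \<inter> space M) \<omega>
                 = (\<Prod>j\<in>J. cond_prob_subalg M F (X j -` A j \<inter> space M) \<omega>)))"

definition converges_L1 :: "'a measure \<Rightarrow> (nat \<Rightarrow> 'a \<Rightarrow> real) \<Rightarrow> ('a \<Rightarrow> real) \<Rightarrow> bool" where
  "converges_L1 M X Y \<longleftrightarrow>
     (\<forall>n. integrable M (X n)) \<and> integrable M Y \<and>
     (\<lambda>n. \<integral>\<omega>. \<bar>X n \<omega> - Y \<omega>\<bar> \<partial>M) \<longlonglongrightarrow> 0"

text \<open>Urns are numbered \<open>1, \<dots>, N\<close>. Throughout, \<open>I t i\<close> is the indicator that the ball added to
  urn \<open>i\<close> at time \<open>t\<close> is red; only \<open>t \<ge> 1\<close> is meaningful.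
  At time \<open>t\<close> an urn contains \<open>a + b + t\<close> balls.\<close>

definition urn_prop ::
    "nat \<Rightarrow> nat \<Rightarrow> (nat \<Rightarrow> nat \<Rightarrow> 'a \<Rightarrow> real) \<Rightarrow> nat \<Rightarrow> nat \<Rightarrow> 'a \<Rightarrow> real" where
  "urn_prop a b I t i \<omega> = (real a + (\<Sum>k=1..t. I k i \<omega>)) / real (a + b + t)"

definition mean_urn_prop ::
    "nat \<Rightarrow> nat \<Rightarrow> nat \<Rightarrow> (nat \<Rightarrow> nat \<Rightarrow> 'a \<Rightarrow> real) \<Rightarrow> nat \<Rightarrow> 'a \<Rightarrow> real" where
  "mean_urn_prop N a b I t \<omega> = (\<Sum>i=1..N. urn_prop a b I t i \<omega>) / real N"

definition urn_filtration ::
    "'a measure \<Rightarrow> nat \<Rightarrow> (nat \<Rightarrow> nat \<Rightarrow> 'a \<Rightarrow> real) \<Rightarrow> nat \<Rightarrow> 'a measure" where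
  "urn_filtration M N I t =
     sigma (space M) (\<Union>k\<in>{1..t}. \<Union>i\<in>{1..N}. {I k i -` B \<inter> space M | B. B \<in> sets borel})"

locale interacting_urns = prob_space M
  for M :: "'a measure" +
  fixes N a b :: nat and \<alpha> :: real and I :: "nat \<Rightarrow> nat \<Rightarrow> 'a \<Rightarrow> real"
  assumes alpha_range: "0 \<le> \<alpha>" "\<alpha> \<le> 1"
    and I_measurable: "\<And>t i. 1 \<le> t \<Longrightarrow> i \<in> {1..N} \<Longrightarrow> I t i \<in> borel_measurable M"
    and I_values: "\<And>t i \<omega>. 1 \<le> t \<Longrightarrow> i \<in> {1..N} \<Longrightarrow> \<omega> \<in> space M \<Longrightarrow> I t i \<omega> \<in> {0, 1}"
    and I_cond_indep:
      "\<And>t. cond_indep_vars M (urn_filtration M N I t) (\<lambda>_. borel) (I (t + 1)) {1..N}"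
    and I_cond_prob:
      "\<And>t j. j \<in> {1..N} \<Longrightarrow>
         AE \<omega> in M. cond_prob_subalg M (urn_filtration M N I t) {\<omega> \<in> space M. I (t + 1) j \<omega> = 1} \<omega>
           = \<alpha> * mean_urn_prop N a b I t \<omega> + (1 - \<alpha>) * urn_prop a b I t j \<omega>"

lemma urn_prop_0: "urn_prop a b I 0 i \<omega> = real a / real (a + b)"
  by (simp add: urn_prop_def)

lemma urn_prop_Suc:
  assumes "a + b > 0"
  shows "urn_prop a b I (t + 1) i \<omega> - urn_prop a b I t i \<omega>
       = (I (t + 1) i \<omega> - urn_prop a b I t i \<omega>) / real (a + b + t + 1)"
proof -
  define S where "S = real a + (\<Sum>k=1..t. I k i \<omega>)"
  define n where "n = real (a + b + t)"
  have "n > 0"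
    unfolding n_def using assms by linarith
  moreover have "urn_prop a b I (t + 1) i \<omega> = (S + I (t + 1) i \<omega>) / (n + 1)"
    and "urn_prop a b I t i \<omega> = S / n"
    by (simp_all add: urn_prop_def S_def n_def add_ac)
  moreover have "real (a + b + t + 1) = n + 1"
    by (simp add: n_def)
  ultimately show ?thesis
    by (simp add: field_simps)
qed

lemma sets_urn_filtration_0: "sets (urn_filtration M N I 0) = {{}, space M}"
  by (simp add: urn_filtration_def sigma_sets_empty_eq)

end

theory Submission
  imports Defs
begin

text \<open>
  Write \<open>m = a + b\<close> and let \<open>X t = Z t j - Z t\<close> be the deviation of urn \<open>j\<close> from the average. Given the
  past, the next draw in urn \<open>i\<close> has mean \<open>\<alpha> Z t + (1 - \<alpha>) Z t i\<close>. Hence the conditional mean of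
  \<open>X (t + 1)\<close> is \<open>(1 - \<alpha> / (m + t + 1)) X t\<close>, and dividing \<open>X t\<close> by the product of the first \<open>t\<close> such
  factors (\<open>decay\<close>) gives a martingale \<open>Y\<close> that starts at \<open>0\<close>. The product is a quotient of Gamma
  functions and behaves like \<open>L t powr (- \<alpha>)\<close> with \<open>L > 0\<close> (\<open>powr_decay_tendsto\<close>), so the
  claim is that \<open>Y\<close> converges to a limit that is not almost surely \<open>0\<close>; the limit wanted is then
  \<open>L\<close> times that of \<open>Y\<close>.

  The increments of \<open>Y\<close> are of order \<open>t powr (\<alpha> - 1)\<close>, so for \<open>\<alpha> < 1/2\<close> their second moments are
  summable. Martingale increments are orthogonal, so \<open>E[(Y n - Y s)\<^sup>2]\<close> is the sum of these second
  moments from \<open>s\<close> to \<open>n\<close>, which is small for large \<open>s\<close>. Kolmogorov's maximal inequality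
  (\<open>maximal_inequality\<close>) improves this to a bound on the probability that \<open>Y\<close> ever moves far from
  \<open>Y s\<close> after time \<open>s\<close>; this makes almost every path Cauchy. Fatou's lemma carries the second moment
  bound over to the limit, which gives convergence in \<open>L\<^sup>2\<close> and so in \<open>L\<^sup>1\<close>.

  Orthogonality also makes the second moment of the limit the sum of those of all increments.
  It vanishes only if \<open>Y\<close> never moves (\<open>lim_eq_initial_imp_incr_var_0\<close>). But the first draw is red in
  urn \<open>j\<close> and black in some other urn with positive probability, by conditional
  independence, and then \<open>Y 1 \<noteq> 0\<close> (\<open>prob_dev_1_pos\<close>).
\<close>

section \<open>Bounded martingales with summable squared increments\<close>

lemma (in prob_space) integrable_bounded:
  fixes f :: "'a \<Rightarrow> real"
  assumes "f \<in> borel_measurable M" and "\<And>\<omega>. \<omega> \<in> space M \<Longrightarrow> \<bar>f \<omega>\<bar> \<le> C"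
  shows "integrable M f"
  by (rule integrable_const_bound[where B = C]) (use assms in auto)

text \<open>The bound depends on the time: a rescaled process such as the one below is bounded at each time,
  which settles integrability, but with bounds that grow.\<close>

locale bounded_martingale = prob_space M
  for M :: "'a measure" +
  fixes F :: "nat \<Rightarrow> 'a measure" and Y :: "nat \<Rightarrow> 'a \<Rightarrow> real" and B :: "nat \<Rightarrow> real"
  assumes subalgebra_F: "\<And>n. subalgebra M (F n)"
    and filtration: "\<And>s n. s \<le> n \<Longrightarrow> subalgebra (F n) (F s)"
    and adapted: "\<And>n. Y n \<in> borel_measurable (F n)"
    and bounded: "\<And>n \<omega>. \<omega> \<in> space M \<Longrightarrow> \<bar>Y n \<omega>\<bar> \<le> B n"
    and cond_exp_Suc: "\<And>n. AE \<omega> in M. real_cond_exp M (F n) (Y (Suc n)) \<omega> = Y n \<omega>"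
begin

definition incr_var :: "nat \<Rightarrow> real" where
  "incr_var n = expectation (\<lambda>\<omega>. (Y (Suc n) \<omega> - Y n \<omega>)\<^sup>2)"

lemma Y_measurable [measurable]: "Y n \<in> borel_measurable M"
  using measurable_from_subalg[OF subalgebra_F adapted] .

lemma Y_measurable_later: "s \<le> n \<Longrightarrow> Y s \<in> borel_measurable (F n)"
  using measurable_from_subalg[OF filtration adapted] .

lemma space_F: "space (F n) = space M"
  using subalgebra_F[of n] by (simp add: subalgebra_def)

lemma sets_F: "A \<in> sets (F n) \<Longrightarrow> A \<in> sets M"
  using subalgebra_F[of n] by (auto simp: subalgebra_def)

lemma sets_F_later: "A \<in> sets (F s) \<Longrightarrow> s \<le> n \<Longrightarrow> A \<in> sets (F n)"
  using filtration[of s n] by (auto simp: subalgebra_def)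

lemma B_nonneg: "0 \<le> B n"
proof -
  obtain \<omega> where "\<omega> \<in> space M"
    using not_empty by auto
  from bounded[OF this, of n] show ?thesis by linarith
qed

lemma Y_integrable: "integrable M (Y n)"
  by (rule integrable_bounded[where C = "B n"]) (auto intro: bounded)

lemma diff_bounded: "\<omega> \<in> space M \<Longrightarrow> \<bar>Y k \<omega> - Y s \<omega>\<bar> \<le> B k + B s"
  using bounded[of \<omega> k] bounded[of \<omega> s] by linarith

lemma weighted_product_integrable:
  assumes [measurable]: "A \<in> sets M"
  shows "integrable M (\<lambda>\<omega>. indicator A \<omega> * ((Y k \<omega> - Y s \<omega>) * (Y l \<omega> - Y n \<omega>)))"
proof (rule integrable_bounded[where C = "(B k + B s) * (B l + B n)"])
  fix \<omega> assume \<omega>: "\<omega> \<in> space M"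
  have "\<bar>(Y k \<omega> - Y s \<omega>) * (Y l \<omega> - Y n \<omega>)\<bar> \<le> (B k + B s) * (B l + B n)"
    unfolding abs_mult using B_nonneg
    by (intro mult_mono diff_bounded \<omega>) (auto intro: add_nonneg_nonneg)
  moreover have "0 \<le> (B k + B s) * (B l + B n)"
    using B_nonneg by (auto intro!: mult_nonneg_nonneg add_nonneg_nonneg)
  ultimately show "\<bar>indicator A \<omega> * ((Y k \<omega> - Y s \<omega>) * (Y l \<omega> - Y n \<omega>))\<bar>
      \<le> (B k + B s) * (B l + B n)"
    by (simp add: indicator_def)
qed measurable

lemma weighted_square_integrable:
  assumes "A \<in> sets M"
  shows "integrable M (\<lambda>\<omega>. indicator A \<omega> * (Y k \<omega> - Y s \<omega>)\<^sup>2)"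
  using weighted_product_integrable[OF assms, of k s k s] by (simp add: power2_eq_square)

lemma square_integrable: "integrable M (\<lambda>\<omega>. (Y k \<omega> - Y s \<omega>)\<^sup>2)"
  using weighted_square_integrable[OF sets.top, of k s]
  by (rule Bochner_Integration.integrable_cong[THEN iffD1, rotated -1]) auto

lemma increment_orthogonal:
  assumes A: "A \<in> sets (F n)" and s: "s \<le> n"
  shows "expectation (\<lambda>\<omega>. indicator A \<omega> * ((Y n \<omega> - Y s \<omega>) * (Y (Suc n) \<omega> - Y n \<omega>))) = 0"
proof -
  interpret F: finite_measure_subalgebra M "F n"
    by unfold_locales (rule subalgebra_F)
  have [measurable]: "A \<in> sets M"
    using A by (rule sets_F)
  let ?W = "\<lambda>\<omega>. indicator A \<omega> * (Y n \<omega> - Y s \<omega>)"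
  have W: "?W \<in> borel_measurable (F n)"
    using A adapted Y_measurable_later[OF s] by measurable
  have bW: "\<bar>?W \<omega> * Y k \<omega>\<bar> \<le> (B n + B s) * B k" if "\<omega> \<in> space M" for \<omega> k
    unfolding abs_mult
    by (intro mult_mono) (use diff_bounded[OF that, of n s] bounded[OF that, of k] B_nonneg in
        \<open>auto simp: indicator_def intro: add_nonneg_nonneg\<close>)
  have int: "integrable M (\<lambda>\<omega>. ?W \<omega> * Y k \<omega>)" for k
    by (rule integrable_bounded[OF _ bW]) measurable
  have "expectation (\<lambda>\<omega>. ?W \<omega> * Y (Suc n) \<omega>)
      = expectation (\<lambda>\<omega>. ?W \<omega> * real_cond_exp M (F n) (Y (Suc n)) \<omega>)"
    by (rule F.real_cond_exp_intg(2)[symmetric, OF int W]) measurable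
  also have "\<dots> = expectation (\<lambda>\<omega>. ?W \<omega> * Y n \<omega>)"
    using cond_exp_Suc[of n] by (intro integral_cong_AE) auto
  finally have "expectation (\<lambda>\<omega>. ?W \<omega> * Y (Suc n) \<omega> - ?W \<omega> * Y n \<omega>) = 0"
    using int by (subst Bochner_Integration.integral_diff) auto
  then show ?thesis by (simp add: algebra_simps)
qed

text \<open>The Pythagorean identity behind everything below. The weight \<open>A\<close> is there for the maximal
  inequality, where it is the event that a level is first exceeded at a given time.\<close>

lemma second_moment_Suc:
  assumes A: "A \<in> sets (F n)" and s: "s \<le> n"
  shows "expectation (\<lambda>\<omega>. indicator A \<omega> * (Y (Suc n) \<omega> - Y s \<omega>)\<^sup>2)
       = expectation (\<lambda>\<omega>. indicator A \<omega> * (Y n \<omega> - Y s \<omega>)\<^sup>2)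
         + expectation (\<lambda>\<omega>. indicator A \<omega> * (Y (Suc n) \<omega> - Y n \<omega>)\<^sup>2)"
proof -
  have AM: "A \<in> sets M"
    using A by (rule sets_F)
  have "expectation (\<lambda>\<omega>. indicator A \<omega> * (Y (Suc n) \<omega> - Y s \<omega>)\<^sup>2)
      = expectation (\<lambda>\<omega>. (indicator A \<omega> * (Y n \<omega> - Y s \<omega>)\<^sup>2
          + indicator A \<omega> * (Y (Suc n) \<omega> - Y n \<omega>)\<^sup>2)
          + 2 * (indicator A \<omega> * ((Y n \<omega> - Y s \<omega>) * (Y (Suc n) \<omega> - Y n \<omega>))))"
    by (rule arg_cong[where f = expectation]) (auto simp: fun_eq_iff power2_eq_square algebra_simps)
  also have "\<dots> = expectation (\<lambda>\<omega>. indicator A \<omega> * (Y n \<omega> - Y s \<omega>)\<^sup>2)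
         + expectation (\<lambda>\<omega>. indicator A \<omega> * (Y (Suc n) \<omega> - Y n \<omega>)\<^sup>2)"
    using weighted_square_integrable[OF AM] weighted_product_integrable[OF AM]
      increment_orthogonal[OF A s]
    by (simp add: Bochner_Integration.integral_add)
  finally show ?thesis .
qed

lemma incr_var_nonneg: "0 \<le> incr_var n"
  unfolding incr_var_def by (rule Bochner_Integration.integral_nonneg) simp

lemma second_moment_eq_sum:
  assumes "s \<le> n"
  shows "expectation (\<lambda>\<omega>. (Y n \<omega> - Y s \<omega>)\<^sup>2) = (\<Sum>k=s..<n. incr_var k)"
  using assms
proof (induction n rule: dec_induct)
  case (step n)
  have top: "expectation (\<lambda>\<omega>. indicator (space M) \<omega> * g \<omega>) = expectation g" for g :: "'a \<Rightarrow> real"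
    by (rule Bochner_Integration.integral_cong) auto
  have "space M \<in> sets (F n)"
    using sets.top[of "F n"] by (simp add: space_F)
  from second_moment_Suc[OF this step.hyps(1)]
  show ?case
    using step by (simp add: top incr_var_def[symmetric])
qed simp

lemma weighted_second_moment_mono:
  assumes "A \<in> sets (F k)" and "s \<le> k" and "k \<le> n"
  shows "expectation (\<lambda>\<omega>. indicator A \<omega> * (Y k \<omega> - Y s \<omega>)\<^sup>2)
       \<le> expectation (\<lambda>\<omega>. indicator A \<omega> * (Y n \<omega> - Y s \<omega>)\<^sup>2)"
  using assms(3)
proof (induction n rule: dec_induct)
  case (step n)
  have "0 \<le> expectation (\<lambda>\<omega>. indicator A \<omega> * (Y (Suc n) \<omega> - Y n \<omega>)\<^sup>2)"
    by (rule Bochner_Integration.integral_nonneg) simp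
  with step.IH second_moment_Suc[OF sets_F_later[OF assms(1) step.hyps(1)] order_trans[OF assms(2) step.hyps(1)]]
  show ?case by linarith
qed simp

text \<open>Kolmogorov's maximal inequality. The event is cut up according to the first time \<open>k\<close> at which
  the level is exceeded; this piece lies in \<open>F k\<close>, and on it the squared deviation can only grow
  in mean after time \<open>k\<close>.\<close>

lemma maximal_inequality:
  assumes \<epsilon>: "0 < \<epsilon>"
  shows "\<epsilon>\<^sup>2 * prob {\<omega> \<in> space M. \<exists>k\<in>{s..n}. \<epsilon> \<le> \<bar>Y k \<omega> - Y s \<omega>\<bar>} \<le> (\<Sum>k=s..<n. incr_var k)"
proof (cases "s \<le> n")
  case True
  define A where "A k = {\<omega> \<in> space M. \<epsilon> \<le> \<bar>Y k \<omega> - Y s \<omega>\<bar> \<and> (\<forall>l\<in>{s..<k}. \<bar>Y l \<omega> - Y s \<omega>\<bar> < \<epsilon>)}" for k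
  have A_F: "A k \<in> sets (F k)" if "s \<le> k" for k
  proof -
    have dev: "(\<lambda>\<omega>. \<bar>Y l \<omega> - Y s \<omega>\<bar>) \<in> borel_measurable (F k)" if "l \<le> k" for l
      using that \<open>s \<le> k\<close> by (intro borel_measurable_abs borel_measurable_diff Y_measurable_later)
    have "{\<omega> \<in> space (F k). \<epsilon> \<le> \<bar>Y k \<omega> - Y s \<omega>\<bar>} \<in> sets (F k)"
      using dev by (intro borel_measurable_le borel_measurable_const) simp
    moreover have "{\<omega> \<in> space (F k). \<forall>l\<in>{s..<k}. \<bar>Y l \<omega> - Y s \<omega>\<bar> < \<epsilon>} \<in> sets (F k)"
    proof (rule sets.sets_Collect_finite_All)
      fix l assume "l \<in> {s..<k}"
      then show "{\<omega> \<in> space (F k). \<bar>Y l \<omega> - Y s \<omega>\<bar> < \<epsilon>} \<in> sets (F k)"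
        using dev by (intro borel_measurable_less borel_measurable_const) simp
    qed simp
    ultimately have "{\<omega> \<in> space (F k). \<epsilon> \<le> \<bar>Y k \<omega> - Y s \<omega>\<bar>}
        \<inter> {\<omega> \<in> space (F k). \<forall>l\<in>{s..<k}. \<bar>Y l \<omega> - Y s \<omega>\<bar> < \<epsilon>} \<in> sets (F k)"
      by (rule sets.Int)
    also have "{\<omega> \<in> space (F k). \<epsilon> \<le> \<bar>Y k \<omega> - Y s \<omega>\<bar>}
        \<inter> {\<omega> \<in> space (F k). \<forall>l\<in>{s..<k}. \<bar>Y l \<omega> - Y s \<omega>\<bar> < \<epsilon>} = A k"
      by (auto simp: A_def space_F)
    finally show ?thesis .
  qed
  have A_M: "A k \<in> sets M" if "s \<le> k" for k
    using A_F[OF that] by (rule sets_F)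
  have sep: "A k \<inter> A l = {}" if "s \<le> k" "k < l" for k l
  proof -
    have False if "\<omega> \<in> A k" "\<omega> \<in> A l" for \<omega>
    proof -
      have "\<bar>Y k \<omega> - Y s \<omega>\<bar> < \<epsilon>"
        using \<open>\<omega> \<in> A l\<close> \<open>s \<le> k\<close> \<open>k < l\<close> by (simp add: A_def)
      with \<open>\<omega> \<in> A k\<close> show False by (simp add: A_def)
    qed
    then show ?thesis by blast
  qed
  have disj: "disjoint_family_on A {s..n}"
    unfolding disjoint_family_on_def
  proof (intro ballI impI)
    fix k l assume "k \<in> {s..n}" "l \<in> {s..n}" "k \<noteq> l"
    then show "A k \<inter> A l = {}"
      using sep[of k l] sep[of l k] by (cases "k < l") auto
  qed
  have first: "{\<omega> \<in> space M. \<exists>k\<in>{s..n}. \<epsilon> \<le> \<bar>Y k \<omega> - Y s \<omega>\<bar>} = (\<Union>k\<in>{s..n}. A k)"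
  proof (intro equalityI subsetI)
    fix \<omega> assume "\<omega> \<in> {\<omega> \<in> space M. \<exists>k\<in>{s..n}. \<epsilon> \<le> \<bar>Y k \<omega> - Y s \<omega>\<bar>}"
    then have \<omega>: "\<omega> \<in> space M" and ex: "\<exists>k. k \<in> {s..n} \<and> \<epsilon> \<le> \<bar>Y k \<omega> - Y s \<omega>\<bar>"
      by auto
    define k where "k = (LEAST k. k \<in> {s..n} \<and> \<epsilon> \<le> \<bar>Y k \<omega> - Y s \<omega>\<bar>)"
    have k: "k \<in> {s..n}" "\<epsilon> \<le> \<bar>Y k \<omega> - Y s \<omega>\<bar>"
      using LeastI_ex[OF ex] unfolding k_def by auto
    have "\<bar>Y l \<omega> - Y s \<omega>\<bar> < \<epsilon>" if "l \<in> {s..<k}" for l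
      using not_less_Least[of l "\<lambda>k. k \<in> {s..n} \<and> \<epsilon> \<le> \<bar>Y k \<omega> - Y s \<omega>\<bar>"] that k(1)
      unfolding k_def[symmetric] by auto
    with k \<omega> show "\<omega> \<in> (\<Union>k\<in>{s..n}. A k)"
      by (auto simp: A_def)
  qed (auto simp: A_def)
  have piece: "\<epsilon>\<^sup>2 * prob (A k) \<le> expectation (\<lambda>\<omega>. indicator (A k) \<omega> * (Y n \<omega> - Y s \<omega>)\<^sup>2)"
    if k: "k \<in> {s..n}" for k
  proof -
    have s: "s \<le> k" using k by simp
    have "\<epsilon>\<^sup>2 * prob (A k) = expectation (\<lambda>\<omega>. indicator (A k) \<omega> * \<epsilon>\<^sup>2)"
      using A_M[OF s] by simp
    also have "\<dots> \<le> expectation (\<lambda>\<omega>. indicator (A k) \<omega> * (Y k \<omega> - Y s \<omega>)\<^sup>2)"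
    proof (rule integral_mono)
      show "integrable M (\<lambda>\<omega>. indicator (A k) \<omega> * \<epsilon>\<^sup>2)"
        using A_M[OF s] by (intro integrable_bounded[where C = "\<epsilon>\<^sup>2"]) (auto simp: indicator_def)
      show "indicator (A k) \<omega> * \<epsilon>\<^sup>2 \<le> indicator (A k) \<omega> * (Y k \<omega> - Y s \<omega>)\<^sup>2" for \<omega>
        using \<epsilon> power_mono[of \<epsilon> "\<bar>Y k \<omega> - Y s \<omega>\<bar>" 2] by (auto simp: indicator_def A_def)
    qed (rule weighted_square_integrable[OF A_M[OF s]])
    also have "\<dots> \<le> expectation (\<lambda>\<omega>. indicator (A k) \<omega> * (Y n \<omega> - Y s \<omega>)\<^sup>2)"
      using k by (intro weighted_second_moment_mono A_F) auto
    finally show ?thesis .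
  qed
  have "\<epsilon>\<^sup>2 * prob {\<omega> \<in> space M. \<exists>k\<in>{s..n}. \<epsilon> \<le> \<bar>Y k \<omega> - Y s \<omega>\<bar>} = (\<Sum>k=s..n. \<epsilon>\<^sup>2 * prob (A k))"
    unfolding first sum_distrib_left[symmetric]
    by (subst finite_measure_finite_Union) (use A_M disj in auto)
  also have "\<dots> \<le> (\<Sum>k=s..n. expectation (\<lambda>\<omega>. indicator (A k) \<omega> * (Y n \<omega> - Y s \<omega>)\<^sup>2))"
    by (intro sum_mono piece)
  also have "\<dots> = expectation (\<lambda>\<omega>. \<Sum>k=s..n. indicator (A k) \<omega> * (Y n \<omega> - Y s \<omega>)\<^sup>2)"
    by (rule Bochner_Integration.integral_sum[symmetric]) (auto intro: weighted_square_integrable A_M)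
  also have "\<dots> \<le> expectation (\<lambda>\<omega>. (Y n \<omega> - Y s \<omega>)\<^sup>2)"
  proof (rule integral_mono)
    show "integrable M (\<lambda>\<omega>. \<Sum>k=s..n. indicator (A k) \<omega> * (Y n \<omega> - Y s \<omega>)\<^sup>2)"
      by (rule Bochner_Integration.integrable_sum) (auto intro: weighted_square_integrable A_M)
    fix \<omega>
    have "(\<Sum>k=s..n. indicator (A k) \<omega>) = (indicator (\<Union>k\<in>{s..n}. A k) \<omega> :: real)"
      using disj by (intro indicator_UN_disjoint[symmetric]) simp_all
    also have "\<dots> \<le> 1" by (simp add: indicator_def)
    finally show "(\<Sum>k=s..n. indicator (A k) \<omega> * (Y n \<omega> - Y s \<omega>)\<^sup>2) \<le> (Y n \<omega> - Y s \<omega>)\<^sup>2"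
      unfolding sum_distrib_right[symmetric] by (intro mult_left_le_one_le) (auto intro!: sum_nonneg)
  qed (rule square_integrable)
  also have "\<dots> = (\<Sum>k=s..<n. incr_var k)"
    by (rule second_moment_eq_sum[OF True])
  finally show ?thesis .
qed (simp add: sum_nonneg incr_var_nonneg)

end

locale l2_bounded_martingale = bounded_martingale +
  assumes summable_incr_var: "summable incr_var"
begin

definition tail_var :: "nat \<Rightarrow> real" where
  "tail_var s = (\<Sum>k. incr_var (k + s))"

definition Y_lim :: "'a \<Rightarrow> real" where
  "Y_lim \<omega> = lim (\<lambda>n. Y n \<omega>)"

lemma Y_lim_measurable [measurable]: "Y_lim \<in> borel_measurable M"
  unfolding Y_lim_def by measurable

lemma sum_incr_var_le_tail: "(\<Sum>k=s..<n. incr_var k) \<le> tail_var s"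
proof (cases "s \<le> n")
  case True
  have "(\<Sum>k=s..<n. incr_var k) = (\<Sum>k<n - s. incr_var (k + s))"
    using True sum.shift_bounds_nat_ivl[of incr_var 0 s "n - s"] by (simp add: atLeast0LessThan)
  also have "\<dots> \<le> tail_var s"
    unfolding tail_var_def
    by (rule sum_le_suminf) (auto simp: summable_iff_shift summable_incr_var incr_var_nonneg)
  finally show ?thesis .
next
  case False
  then show ?thesis
    unfolding tail_var_def using summable_incr_var incr_var_nonneg
    by (auto intro!: suminf_nonneg simp: summable_iff_shift)
qed

lemma tail_var_nonneg: "0 \<le> tail_var s"
  using sum_incr_var_le_tail[of s s] by simp

lemma tail_var_tendsto: "tail_var \<longlonglongrightarrow> 0"
  unfolding tail_var_def using summable_incr_var by (rule suminf_exist_split2)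

lemma tail_maximal_inequality:
  assumes "0 < \<epsilon>"
  shows "prob {\<omega> \<in> space M. \<exists>k\<ge>s. \<epsilon> \<le> \<bar>Y k \<omega> - Y s \<omega>\<bar>} \<le> tail_var s / \<epsilon>\<^sup>2"
proof -
  define E where "E n = {\<omega> \<in> space M. \<exists>k\<in>{s..n}. \<epsilon> \<le> \<bar>Y k \<omega> - Y s \<omega>\<bar>}" for n
  have "E n \<in> sets M" for n
    unfolding E_def by measurable
  moreover have "incseq E"
    unfolding E_def incseq_def by (auto intro: order_trans)
  ultimately have "(\<lambda>n. prob (E n)) \<longlonglongrightarrow> prob (\<Union>n. E n)"
    by (intro finite_Lim_measure_incseq) auto
  moreover have "prob (E n) \<le> tail_var s / \<epsilon>\<^sup>2" for n
    using maximal_inequality[OF assms, of s n] sum_incr_var_le_tail[of s n] assms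
    unfolding E_def by (simp add: pos_le_divide_eq mult.commute)
  ultimately have "prob (\<Union>n. E n) \<le> tail_var s / \<epsilon>\<^sup>2"
    by (auto intro: LIMSEQ_le_const2)
  moreover have "(\<Union>n. E n) = {\<omega> \<in> space M. \<exists>k\<ge>s. \<epsilon> \<le> \<bar>Y k \<omega> - Y s \<omega>\<bar>}"
    by (auto simp: E_def) (metis atLeastAtMost_iff order_refl)
  ultimately show ?thesis by simp
qed

lemma AE_eventually_close:
  assumes "0 < \<epsilon>"
  shows "AE \<omega> in M. \<exists>s. \<forall>k\<ge>s. \<bar>Y k \<omega> - Y s \<omega>\<bar> < \<epsilon>"
proof -
  define N where "N = {\<omega> \<in> space M. \<forall>s. \<exists>k\<ge>s. \<epsilon> \<le> \<bar>Y k \<omega> - Y s \<omega>\<bar>}"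
  have [measurable]: "N \<in> sets M"
    unfolding N_def by measurable
  have "prob N \<le> tail_var s / \<epsilon>\<^sup>2" for s
  proof -
    have "prob N \<le> prob {\<omega> \<in> space M. \<exists>k\<ge>s. \<epsilon> \<le> \<bar>Y k \<omega> - Y s \<omega>\<bar>}"
      by (rule finite_measure_mono) (auto simp: N_def)
    also note tail_maximal_inequality[OF assms]
    finally show ?thesis .
  qed
  moreover have "(\<lambda>s. tail_var s / \<epsilon>\<^sup>2) \<longlonglongrightarrow> 0"
    using tendsto_divide[OF tail_var_tendsto tendsto_const] assms by fastforce
  ultimately have "prob N \<le> 0"
    by (intro LIMSEQ_le_const) auto
  then have "N \<in> null_sets M"
    by (auto simp: null_sets_def emeasure_eq_measure intro: antisym)
  then show ?thesis
    by (rule AE_I') (auto simp: N_def not_less)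
qed

lemma AE_convergent: "AE \<omega> in M. (\<lambda>n. Y n \<omega>) \<longlonglongrightarrow> Y_lim \<omega>"
proof -
  have "AE \<omega> in M. \<forall>r::nat. \<exists>s. \<forall>k\<ge>s. \<bar>Y k \<omega> - Y s \<omega>\<bar> < inverse (real (Suc r))"
    unfolding AE_all_countable by (auto intro: AE_eventually_close)
  then show ?thesis
  proof eventually_elim
    case (elim \<omega>)
    have "Cauchy (\<lambda>n. Y n \<omega>)"
      unfolding Cauchy_altdef2 dist_real_def
    proof (intro allI impI)
      fix e :: real assume "0 < e"
      then obtain r where "inverse (real (Suc r)) < e"
        using reals_Archimedean by blast
      with elim[rule_format, of r] show "\<exists>s. \<forall>k\<ge>s. \<bar>Y k \<omega> - Y s \<omega>\<bar> < e"
        by (meson less_trans)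
    qed
    then show ?case
      unfolding Y_lim_def by (simp add: Cauchy_convergent_iff convergent_LIMSEQ_iff)
  qed
qed

text \<open>Fatou's lemma, applied to \<open>(Y m - Y s)\<^sup>2\<close> as \<open>m\<close> grows, transfers the bound for finite
  times to the limit.\<close>

lemma nn_integral_lim_square_le: "(\<integral>\<^sup>+\<omega>. ennreal ((Y_lim \<omega> - Y s \<omega>)\<^sup>2) \<partial>M) \<le> ennreal (tail_var s)"
proof -
  have "(\<integral>\<^sup>+\<omega>. ennreal ((Y_lim \<omega> - Y s \<omega>)\<^sup>2) \<partial>M)
      = (\<integral>\<^sup>+\<omega>. liminf (\<lambda>n. ennreal ((Y n \<omega> - Y s \<omega>)\<^sup>2)) \<partial>M)"
  proof (rule nn_integral_cong_AE)
    show "AE \<omega> in M. ennreal ((Y_lim \<omega> - Y s \<omega>)\<^sup>2) = liminf (\<lambda>n. ennreal ((Y n \<omega> - Y s \<omega>)\<^sup>2))"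
      using AE_convergent
    proof eventually_elim
      case (elim \<omega>)
      then have "(\<lambda>n. ennreal ((Y n \<omega> - Y s \<omega>)\<^sup>2)) \<longlonglongrightarrow> ennreal ((Y_lim \<omega> - Y s \<omega>)\<^sup>2)"
        by (intro tendsto_ennrealI tendsto_intros)
      then show ?case
        by (rule lim_imp_Liminf[OF sequentially_bot, symmetric])
    qed
  qed
  also have "\<dots> \<le> liminf (\<lambda>n. \<integral>\<^sup>+\<omega>. ennreal ((Y n \<omega> - Y s \<omega>)\<^sup>2) \<partial>M)"
    by (rule nn_integral_liminf) measurable
  also have "\<dots> \<le> ennreal (tail_var s)"
  proof -
    have "(\<integral>\<^sup>+\<omega>. ennreal ((Y n \<omega> - Y s \<omega>)\<^sup>2) \<partial>M) \<le> ennreal (tail_var s)" if "s \<le> n" for n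
      using sum_incr_var_le_tail[of s n] second_moment_eq_sum[OF that]
      by (subst nn_integral_eq_integral[OF square_integrable]) (auto intro: ennreal_leI)
    then have "liminf (\<lambda>n. \<integral>\<^sup>+\<omega>. ennreal ((Y n \<omega> - Y s \<omega>)\<^sup>2) \<partial>M) \<le> liminf (\<lambda>n. ennreal (tail_var s))"
      by (intro Liminf_mono) (auto simp: eventually_sequentially)
    then show ?thesis by (simp add: Liminf_const)
  qed
  finally show ?thesis .
qed

lemma lim_square_integrable: "integrable M (\<lambda>\<omega>. (Y_lim \<omega> - Y s \<omega>)\<^sup>2)"
  using nn_integral_lim_square_le[of s]
  by (intro integrableI_nonneg) (auto intro: le_less_trans)

lemma lim_second_moment_le: "expectation (\<lambda>\<omega>. (Y_lim \<omega> - Y s \<omega>)\<^sup>2) \<le> tail_var s"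
  using nn_integral_lim_square_le[of s]
  by (subst (asm) nn_integral_eq_integral[OF lim_square_integrable]) (auto simp: tail_var_nonneg)

lemma Y_lim_integrable: "integrable M Y_lim"
proof -
  have "integrable M (\<lambda>\<omega>. Y_lim \<omega> - Y 0 \<omega>)"
    by (rule square_integrable_imp_integrable[OF _ lim_square_integrable]) measurable
  then have "integrable M (\<lambda>\<omega>. (Y_lim \<omega> - Y 0 \<omega>) + Y 0 \<omega>)"
    by (intro Bochner_Integration.integrable_add Y_integrable)
  then show ?thesis by simp
qed

lemma L1_convergent: "converges_L1 M Y Y_lim"
  unfolding converges_L1_def
proof (intro conjI allI)
  have le: "expectation (\<lambda>\<omega>. \<bar>Y n \<omega> - Y_lim \<omega>\<bar>) \<le> sqrt (tail_var n)" for n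
  proof -
    let ?f = "\<lambda>\<omega>. \<bar>Y n \<omega> - Y_lim \<omega>\<bar>"
    have sq: "integrable M (\<lambda>\<omega>. (?f \<omega>)\<^sup>2)"
      using lim_square_integrable[of n] by (simp add: power2_commute)
    have f: "integrable M ?f"
      by (intro Bochner_Integration.integrable_abs Bochner_Integration.integrable_diff
          Y_integrable Y_lim_integrable)
    \<comment> \<open>the mean is at most the root mean square, because the variance is nonnegative\<close>
    have "(expectation ?f)\<^sup>2 \<le> expectation (\<lambda>\<omega>. (?f \<omega>)\<^sup>2)"
      using variance_eq[OF f sq] variance_positive[of ?f] by simp
    also have "\<dots> \<le> tail_var n"
      using lim_second_moment_le[of n] by (simp add: power2_commute)
    finally show ?thesis by (rule real_le_rsqrt)
  qed
  show "(\<lambda>n. expectation (\<lambda>\<omega>. \<bar>Y n \<omega> - Y_lim \<omega>\<bar>)) \<longlonglongrightarrow> 0"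
  proof (rule tendsto_sandwich[OF _ _ tendsto_const])
    show "(\<lambda>n. sqrt (tail_var n)) \<longlonglongrightarrow> 0"
      using tendsto_real_sqrt[OF tail_var_tendsto] by simp
  qed (use le in auto)
qed (auto intro: Y_integrable Y_lim_integrable)

text \<open>If the limit were the initial value, \<open>E[(Y n - Y 0)\<^sup>2]\<close> would be both the sum of the first
  \<open>n\<close> increment variances and at most the sum of the others; as \<open>n\<close> grows, this
  forces all of them to vanish.\<close>

lemma lim_eq_initial_imp_incr_var_0:
  assumes "AE \<omega> in M. Y_lim \<omega> = Y 0 \<omega>"
  shows "incr_var k = 0"
proof -
  have "(\<Sum>k<n. incr_var k) \<le> tail_var n" for n
  proof -
    have "(\<Sum>k<n. incr_var k) = expectation (\<lambda>\<omega>. (Y n \<omega> - Y 0 \<omega>)\<^sup>2)"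
      using second_moment_eq_sum[of 0 n] by (simp add: atLeast0LessThan)
    also have "\<dots> = expectation (\<lambda>\<omega>. (Y_lim \<omega> - Y n \<omega>)\<^sup>2)"
      using assms by (intro integral_cong_AE) (auto simp: power2_commute)
    also note lim_second_moment_le
    finally show ?thesis .
  qed
  then have "suminf incr_var \<le> 0"
    using LIMSEQ_le[OF summable_LIMSEQ[OF summable_incr_var] tail_var_tendsto] by blast
  moreover have "0 \<le> suminf incr_var"
    by (rule suminf_nonneg[OF summable_incr_var incr_var_nonneg])
  ultimately show ?thesis
    using suminf_eq_zero_iff[OF summable_incr_var incr_var_nonneg] by simp
qed

end

lemma converges_L1_scale:
  assumes Y: "converges_L1 M Y D" and c: "c \<longlonglongrightarrow> (L :: real)"
  shows "converges_L1 M (\<lambda>n \<omega>. c n * Y n \<omega>) (\<lambda>\<omega>. L * D \<omega>)"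
proof -
  have int: "integrable M (Y n)" "integrable M D" for n
    using Y by (auto simp: converges_L1_def)
  have lim: "(\<lambda>n. \<integral>\<omega>. \<bar>Y n \<omega> - D \<omega>\<bar> \<partial>M) \<longlonglongrightarrow> 0"
    using Y by (auto simp: converges_L1_def)
  have int_diff: "integrable M (\<lambda>\<omega>. \<bar>Y n \<omega> - D \<omega>\<bar>)" for n
    using int by (intro Bochner_Integration.integrable_abs Bochner_Integration.integrable_diff)
  define g where "g n = \<bar>c n\<bar> * (\<integral>\<omega>. \<bar>Y n \<omega> - D \<omega>\<bar> \<partial>M) + \<bar>c n - L\<bar> * (\<integral>\<omega>. \<bar>D \<omega>\<bar> \<partial>M)" for n
  have le: "(\<integral>\<omega>. \<bar>c n * Y n \<omega> - L * D \<omega>\<bar> \<partial>M) \<le> g n" for n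
  proof -
    have "(\<integral>\<omega>. \<bar>c n * Y n \<omega> - L * D \<omega>\<bar> \<partial>M)
        \<le> (\<integral>\<omega>. \<bar>c n\<bar> * \<bar>Y n \<omega> - D \<omega>\<bar> + \<bar>c n - L\<bar> * \<bar>D \<omega>\<bar> \<partial>M)"
    proof (rule integral_mono)
      show "integrable M (\<lambda>\<omega>. \<bar>c n * Y n \<omega> - L * D \<omega>\<bar>)"
        using int by auto
      show "integrable M (\<lambda>\<omega>. \<bar>c n\<bar> * \<bar>Y n \<omega> - D \<omega>\<bar> + \<bar>c n - L\<bar> * \<bar>D \<omega>\<bar>)"
        using int int_diff by auto
      fix \<omega>
      have "c n * Y n \<omega> - L * D \<omega> = c n * (Y n \<omega> - D \<omega>) + (c n - L) * D \<omega>"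
        by (simp add: algebra_simps)
      then show "\<bar>c n * Y n \<omega> - L * D \<omega>\<bar> \<le> \<bar>c n\<bar> * \<bar>Y n \<omega> - D \<omega>\<bar> + \<bar>c n - L\<bar> * \<bar>D \<omega>\<bar>"
        by (metis abs_mult abs_triangle_ineq)
    qed
    also have "\<dots> = g n"
      unfolding g_def using int int_diff by (subst Bochner_Integration.integral_add) auto
    finally show ?thesis .
  qed
  have "g \<longlonglongrightarrow> \<bar>L\<bar> * 0 + \<bar>L - L\<bar> * (\<integral>\<omega>. \<bar>D \<omega>\<bar> \<partial>M)"
    unfolding g_def by (intro tendsto_intros c lim)
  then have g: "g \<longlonglongrightarrow> 0" by simp
  have "(\<lambda>n. \<integral>\<omega>. \<bar>c n * Y n \<omega> - L * D \<omega>\<bar> \<partial>M) \<longlonglongrightarrow> 0"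
    by (rule tendsto_sandwich[OF _ _ tendsto_const g]) (use le in auto)
  then show ?thesis
    using int by (auto simp: converges_L1_def)
qed

section \<open>The deterministic decay of the conditional means\<close>

definition decay :: "real \<Rightarrow> nat \<Rightarrow> nat \<Rightarrow> real" where
  "decay \<alpha> m t = (\<Prod>k<t. 1 - \<alpha> / real (m + k + 1))"

lemma decay_0 [simp]: "decay \<alpha> m 0 = 1"
  by (simp add: decay_def)

lemma decay_Suc: "decay \<alpha> m (Suc t) = (1 - \<alpha> / real (m + t + 1)) * decay \<alpha> m t"
  by (simp add: decay_def mult.commute)

lemma decay_factor_pos:
  assumes "\<alpha> < 1"
  shows "0 < 1 - \<alpha> / real (m + t + 1)"
  using assms by (simp add: field_simps)

lemma decay_pos: "\<alpha> < 1 \<Longrightarrow> 0 < decay \<alpha> m t"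
  unfolding decay_def by (intro prod_pos ballI decay_factor_pos)

lemma decay_pochhammer:
  "decay \<alpha> m t = pochhammer (real m + 1 - \<alpha>) t / pochhammer (real m + 1) t"
proof -
  have "1 - \<alpha> / real (m + k + 1) = (real m + 1 - \<alpha> + real k) / (real m + 1 + real k)" for k
    by (simp add: field_simps)
  then show ?thesis
    unfolding decay_def pochhammer_prod prod_dividef[symmetric] by (simp add: atLeast0LessThan)
qed

text \<open>Written with Pochhammer symbols, the product is a quotient of two of Euler's
  sequences for \<open>1 / \<Gamma>\<close>, at \<open>m + 1 - \<alpha>\<close> and at \<open>m + 1\<close>.\<close>

lemma powr_decay_tendsto:
  assumes "\<alpha> < 1"
  shows "(\<lambda>t. real t powr \<alpha> * decay \<alpha> m t) \<longlonglongrightarrow> Gamma (real m + 1) / Gamma (real m + 1 - \<alpha>)"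
proof -
  define z where "z = real m + 1"
  have z: "0 < z" "0 < z - \<alpha>"
    using assms by (simp_all add: z_def)
  have "(\<lambda>t. rGamma_series (z - \<alpha>) t / rGamma_series z t / (1 - \<alpha> / real (m + t + 1)))
      \<longlonglongrightarrow> rGamma (z - \<alpha>) / rGamma z / (1 - 0)"
  proof (intro tendsto_intros rGamma_series_LIMSEQ)
    show "(\<lambda>t. \<alpha> / real (m + t + 1)) \<longlonglongrightarrow> 0"
      using LIMSEQ_ignore_initial_segment[OF lim_const_over_n[of \<alpha>], of "m + 1"] by (simp add: add_ac)
    show "rGamma z \<noteq> 0"
      using z by (auto simp: rGamma_inverse_Gamma Gamma_real_pos less_imp_neq[symmetric])
  qed simp
  moreover have "\<forall>\<^sub>F t in sequentially.
      rGamma_series (z - \<alpha>) t / rGamma_series z t / (1 - \<alpha> / real (m + t + 1))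
        = real t powr \<alpha> * decay \<alpha> m t"
    using eventually_gt_at_top[of 0]
  proof eventually_elim
    case (elim t)
    have "rGamma_series (z - \<alpha>) t / rGamma_series z t
        = pochhammer (z - \<alpha>) (Suc t) / pochhammer z (Suc t) * (exp (z * ln (real t)) / exp ((z - \<alpha>) * ln (real t)))"
      by (simp add: rGamma_series_def)
    also have "exp (z * ln (real t)) / exp ((z - \<alpha>) * ln (real t)) = real t powr \<alpha>"
      using elim by (simp add: powr_def exp_diff[symmetric] algebra_simps)
    also have "pochhammer (z - \<alpha>) (Suc t) / pochhammer z (Suc t) = decay \<alpha> m (Suc t)"
      by (simp add: decay_pochhammer z_def)
    finally show ?case
      using decay_factor_pos[OF assms, of m t] by (simp add: decay_Suc del: of_nat_add)
  qed
  ultimately have "(\<lambda>t. real t powr \<alpha> * decay \<alpha> m t) \<longlonglongrightarrow> rGamma (z - \<alpha>) / rGamma z"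
    by (simp add: tendsto_cong)
  then show ?thesis
    by (simp add: rGamma_inverse_Gamma z_def field_simps)
qed

lemma inverse_decay_le:
  assumes "\<alpha> < 1"
  obtains K where "\<And>t. 1 \<le> t \<Longrightarrow> 1 / decay \<alpha> m t \<le> K * real t powr \<alpha>"
proof -
  have "0 < Gamma (real m + 1) / Gamma (real m + 1 - \<alpha>)"
    using assms by (intro divide_pos_pos Gamma_real_pos) auto
  then have "(\<lambda>t. inverse (real t powr \<alpha> * decay \<alpha> m t))
      \<longlonglongrightarrow> inverse (Gamma (real m + 1) / Gamma (real m + 1 - \<alpha>))"
    by (intro tendsto_inverse powr_decay_tendsto assms) linarith
  then have "Bseq (\<lambda>t. inverse (real t powr \<alpha> * decay \<alpha> m t))"
    by (intro convergent_imp_Bseq convergentI)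
  then obtain K where K: "\<And>t. norm (inverse (real t powr \<alpha> * decay \<alpha> m t)) \<le> K"
    by (auto simp: Bseq_def)
  show ?thesis
  proof
    fix t :: nat assume "1 \<le> t"
    then show "1 / decay \<alpha> m t \<le> K * real t powr \<alpha>"
      using K[of t] decay_pos[OF assms, of m t] by (simp add: field_simps abs_mult)
  qed
qed

section \<open>The urns\<close>

context interacting_urns
begin

abbreviation "\<F> \<equiv> urn_filtration M N I"

lemma space_\<F> [simp]: "space (\<F> t) = space M"
  unfolding urn_filtration_def by (rule space_measure_of) auto

lemma sets_\<F>:
  "sets (\<F> t) = sigma_sets (space M)
     (\<Union>k\<in>{1..t}. \<Union>i\<in>{1..N}. {I k i -` B \<inter> space M | B. B \<in> sets borel})"
  unfolding urn_filtration_def by (rule sets_measure_of) auto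

lemma subalgebra_\<F>: "subalgebra M (\<F> t)"
  unfolding subalgebra_def sets_\<F>
  by (auto intro!: sets.sigma_sets_subset measurable_sets[OF I_measurable])

lemma subalgebra_\<F>_mono: "s \<le> t \<Longrightarrow> subalgebra (\<F> t) (\<F> s)"
  unfolding subalgebra_def sets_\<F> space_\<F>
  by (intro conjI refl sigma_sets_mono' UN_mono) auto

lemma I_measurable_\<F>:
  assumes "1 \<le> k" "k \<le> t" "i \<in> {1..N}"
  shows "I k i \<in> borel_measurable (\<F> t)"
proof (rule measurableI)
  fix B :: "real set" assume "B \<in> sets borel"
  show "I k i -` B \<inter> space (\<F> t) \<in> sets (\<F> t)"
    unfolding sets_\<F> space_\<F> using assms \<open>B \<in> sets borel\<close>
    by (intro sigma_sets.Basic UN_I[of k] UN_I[of i] CollectI exI[of _ B] conjI refl) auto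
qed simp

lemma urn_prop_measurable_\<F>: "i \<in> {1..N} \<Longrightarrow> urn_prop a b I t i \<in> borel_measurable (\<F> t)"
  unfolding urn_prop_def[abs_def]
  by (intro borel_measurable_divide borel_measurable_add borel_measurable_sum
      borel_measurable_const I_measurable_\<F>) auto

lemma mean_urn_prop_measurable_\<F>: "mean_urn_prop N a b I t \<in> borel_measurable (\<F> t)"
  unfolding mean_urn_prop_def[abs_def]
  by (intro borel_measurable_divide borel_measurable_sum borel_measurable_const urn_prop_measurable_\<F>)

lemma I_integrable:
  assumes "1 \<le> t" "i \<in> {1..N}"
  shows "integrable M (I t i)"
proof (rule integrable_const_bound[where B = 1])
  show "AE \<omega> in M. norm (I t i \<omega>) \<le> 1"
    using I_values[OF assms] by (intro AE_I2) fastforce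
qed (rule I_measurable[OF assms])

lemma cond_exp_I:
  assumes "i \<in> {1..N}"
  shows "AE \<omega> in M. real_cond_exp M (\<F> t) (I (Suc t) i) \<omega>
           = \<alpha> * mean_urn_prop N a b I t \<omega> + (1 - \<alpha>) * urn_prop a b I t i \<omega>"
proof -
  interpret F: finite_measure_subalgebra M "\<F> t"
    by unfold_locales (rule subalgebra_\<F>)
  have [measurable]: "I (Suc t) i \<in> borel_measurable M"
    using assms by (intro I_measurable) auto
  have "AE \<omega> in M. indicat_real {\<omega> \<in> space M. I (Suc t) i \<omega> = 1} \<omega> = I (Suc t) i \<omega>"
    using I_values[of "Suc t" i] assms by (intro AE_I2) (auto simp: indicator_def)
  then have "AE \<omega> in M. real_cond_exp M (\<F> t) (indicat_real {\<omega> \<in> space M. I (Suc t) i \<omega> = 1}) \<omega>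
      = real_cond_exp M (\<F> t) (I (Suc t) i) \<omega>"
    by (rule F.real_cond_exp_cong) measurable
  then show ?thesis
    using I_cond_prob[OF assms, of t] by (auto simp: cond_prob_subalg_def)
qed

lemma prob_eq_of_cond_prob:
  assumes A: "A \<in> sets M" and p: "AE \<omega> in M. cond_prob_subalg M (\<F> t) A \<omega> = p"
  shows "prob A = p"
proof -
  interpret F: finite_measure_subalgebra M "\<F> t"
    by unfold_locales (rule subalgebra_\<F>)
  have "prob A = expectation (cond_prob_subalg M (\<F> t) A)"
    unfolding cond_prob_subalg_def using A
    by (subst F.real_cond_exp_int(2)) (auto simp: integrable_indicator_iff emeasure_eq_measure)
  also have "\<dots> = expectation (\<lambda>_. p)"
    using p by (intro integral_cong_AE) (auto simp: cond_prob_subalg_def)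
  finally show ?thesis by (simp add: prob_space)
qed

end

locale weakly_interacting_urns = interacting_urns +
  assumes N_gt_1: "1 < N" and a_pos: "1 \<le> a" and b_pos: "1 \<le> b"
    and \<alpha>_pos: "0 < \<alpha>" and \<alpha>_less_half: "\<alpha> < 1 / 2"
begin

lemma urn_prop_range:
  assumes "i \<in> {1..N}" "\<omega> \<in> space M"
  shows "0 \<le> urn_prop a b I t i \<omega>" "urn_prop a b I t i \<omega> \<le> 1"
proof -
  have I: "0 \<le> I k i \<omega>" "I k i \<omega> \<le> 1" if "k \<in> {1..t}" for k
    using I_values[of k i \<omega>] that assms by auto
  have "0 \<le> (\<Sum>k=1..t. I k i \<omega>)"
    using I by (intro sum_nonneg) auto
  moreover have "(\<Sum>k=1..t. I k i \<omega>) \<le> real t"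
    using sum_bounded_above[of "{1..t}" "\<lambda>k. I k i \<omega>" 1] I by auto
  ultimately show "0 \<le> urn_prop a b I t i \<omega>" "urn_prop a b I t i \<omega> \<le> 1"
    using a_pos by (auto simp: urn_prop_def divide_le_eq_1)
qed

lemma urn_prop_Suc_eq:
  "urn_prop a b I (Suc t) i \<omega>
     = (1 - 1 / real (a + b + t + 1)) * urn_prop a b I t i \<omega> + (1 / real (a + b + t + 1)) * I (Suc t) i \<omega>"
  using urn_prop_Suc[of a b I t i \<omega>] a_pos
  by (simp add: algebra_simps diff_divide_distrib)

lemma abs_urn_prop_step:
  assumes "i \<in> {1..N}" "\<omega> \<in> space M"
  shows "\<bar>urn_prop a b I (Suc t) i \<omega> - urn_prop a b I t i \<omega>\<bar> \<le> 1 / real (a + b + t + 1)"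
proof -
  have "\<bar>I (Suc t) i \<omega> - urn_prop a b I t i \<omega>\<bar> \<le> 1"
    using urn_prop_range[OF assms, of t] I_values[of "Suc t", OF _ assms] by auto
  then show ?thesis
    using urn_prop_Suc[of a b I t i \<omega>] a_pos by (simp add: abs_divide divide_right_mono)
qed

lemma abs_average_le:
  assumes "\<And>i. i \<in> {1..N} \<Longrightarrow> \<bar>f i\<bar> \<le> (c :: real)"
  shows "\<bar>(\<Sum>i=1..N. f i) / real N\<bar> \<le> c"
proof -
  have "\<bar>\<Sum>i=1..N. f i\<bar> \<le> (\<Sum>i=1..N. c)"
    by (rule order_trans[OF sum_abs sum_mono]) (rule assms)
  then show ?thesis
    using N_gt_1 by (simp add: field_simps)
qed

lemma urn_prop_integrable:
  assumes "i \<in> {1..N}"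
  shows "integrable M (urn_prop a b I t i)"
  using measurable_from_subalg[OF subalgebra_\<F> urn_prop_measurable_\<F>[OF assms]] urn_prop_range[OF assms]
  by (intro integrable_const_bound[where B = 1]) (auto intro!: AE_I2)

lemma mean_urn_prop_integrable: "integrable M (mean_urn_prop N a b I t)"
  unfolding mean_urn_prop_def[abs_def]
  by (intro integrable_divide_zero Bochner_Integration.integrable_sum urn_prop_integrable)

text \<open>One step pulls every urn towards the average, in conditional mean, by the same factor; hence
  the average itself keeps its conditional mean.\<close>

lemma cond_exp_urn_prop:
  assumes i: "i \<in> {1..N}"
  shows "AE \<omega> in M. real_cond_exp M (\<F> t) (urn_prop a b I (Suc t) i) \<omega>
           = urn_prop a b I t i \<omega>
             + \<alpha> / real (a + b + t + 1) * (mean_urn_prop N a b I t \<omega> - urn_prop a b I t i \<omega>)"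
proof -
  interpret F: finite_measure_subalgebra M "\<F> t"
    by unfold_locales (rule subalgebra_\<F>)
  define r where "r = 1 / real (a + b + t + 1)"
  have step: "urn_prop a b I (Suc t) i = (\<lambda>\<omega>. (1 - r) * urn_prop a b I t i \<omega> + r * I (Suc t) i \<omega>)"
    by (rule ext) (simp only: urn_prop_Suc_eq r_def)
  have int: "integrable M (I (Suc t) i)"
    by (rule I_integrable) (use i in auto)
  have old: "integrable M (\<lambda>\<omega>. (1 - r) * urn_prop a b I t i \<omega>)"
    and new: "integrable M (\<lambda>\<omega>. r * I (Suc t) i \<omega>)"
    by (intro integrable_mult_right urn_prop_integrable[OF i] int)+
  have "(\<lambda>\<omega>. (1 - r) * urn_prop a b I t i \<omega>) \<in> borel_measurable (\<F> t)"
    using urn_prop_measurable_\<F>[OF i] by measurable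
  from F.real_cond_exp_F_meas[OF old this] F.real_cond_exp_add[OF old new]
    F.real_cond_exp_cmult[OF int, of r] cond_exp_I[OF i, of t]
  have "AE \<omega> in M. real_cond_exp M (\<F> t) (urn_prop a b I (Suc t) i) \<omega>
      = (1 - r) * urn_prop a b I t i \<omega>
        + r * (\<alpha> * mean_urn_prop N a b I t \<omega> + (1 - \<alpha>) * urn_prop a b I t i \<omega>)"
    unfolding step by eventually_elim simp
  moreover have "\<alpha> / real (a + b + t + 1) = r * \<alpha>"
    by (simp add: r_def)
  ultimately show ?thesis
    by (auto simp: algebra_simps)
qed

lemma cond_exp_mean_urn_prop:
  "AE \<omega> in M. real_cond_exp M (\<F> t) (mean_urn_prop N a b I (Suc t)) \<omega> = mean_urn_prop N a b I t \<omega>"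
proof -
  interpret F: finite_measure_subalgebra M "\<F> t"
    by unfold_locales (rule subalgebra_\<F>)
  \<comment> \<open>extended by \<open>0\<close> to urn numbers outside \<open>{1..N}\<close>, so as to be integrable for every \<open>i\<close>\<close>
  define f where "f i = (if i \<in> {1..N} then urn_prop a b I (Suc t) i else (\<lambda>_. 0))" for i
  have f: "integrable M (f i)" for i
    by (simp add: f_def urn_prop_integrable)
  have mean: "mean_urn_prop N a b I (Suc t) = (\<lambda>\<omega>. (\<Sum>i\<in>{1..N}. f i \<omega>) / real N)"
    by (simp add: mean_urn_prop_def fun_eq_iff f_def)
  let ?g = "\<lambda>i \<omega>. urn_prop a b I t i \<omega>
             + \<alpha> / real (a + b + t + 1) * (mean_urn_prop N a b I t \<omega> - urn_prop a b I t i \<omega>)"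
  have "AE \<omega> in M. \<forall>i\<in>{1..N}. real_cond_exp M (\<F> t) (f i) \<omega> = ?g i \<omega>"
    using cond_exp_urn_prop by (intro AE_finite_allI) (auto simp: f_def)
  moreover note F.real_cond_exp_sum[where f = f and I = "{1..N}", OF f]
  moreover have "integrable M (\<lambda>\<omega>. \<Sum>i\<in>{1..N}. f i \<omega>)"
    by (intro Bochner_Integration.integrable_sum f)
  note F.real_cond_exp_cdiv[OF this, of "real N"]
  ultimately have "AE \<omega> in M. real_cond_exp M (\<F> t) (mean_urn_prop N a b I (Suc t)) \<omega> = (\<Sum>i=1..N. ?g i \<omega>) / real N"
    unfolding mean by eventually_elim simp
  moreover have "(\<Sum>i=1..N. urn_prop a b I t i \<omega> + q * (mean_urn_prop N a b I t \<omega> - urn_prop a b I t i \<omega>)) / real N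
      = mean_urn_prop N a b I t \<omega>" for q \<omega>
  proof -
    have "(\<Sum>i=1..N. urn_prop a b I t i \<omega>) = real N * mean_urn_prop N a b I t \<omega>"
      using N_gt_1 by (simp add: mean_urn_prop_def)
    then show ?thesis
      using N_gt_1 by (simp add: sum.distrib sum_subtractf flip: sum_distrib_left)
  qed
  ultimately show ?thesis by (simp only:)
qed

end

locale tagged_urn = weakly_interacting_urns +
  fixes j :: nat
  assumes j_urn: "j \<in> {1..N}"
begin

definition dev :: "nat \<Rightarrow> 'a \<Rightarrow> real" where
  "dev t \<omega> = urn_prop a b I t j \<omega> - mean_urn_prop N a b I t \<omega>"

lemma \<alpha>_less_1: "\<alpha> < 1"
  using \<alpha>_less_half by simp

lemma dev_0: "dev 0 \<omega> = 0"
  using N_gt_1 by (simp add: dev_def mean_urn_prop_def urn_prop_0)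

lemma dev_measurable_\<F>: "dev t \<in> borel_measurable (\<F> t)"
  unfolding dev_def[abs_def]
  by (intro borel_measurable_diff urn_prop_measurable_\<F> mean_urn_prop_measurable_\<F> j_urn)

lemma abs_dev_le:
  assumes "\<omega> \<in> space M"
  shows "\<bar>dev t \<omega>\<bar> \<le> 1"
proof -
  have "0 \<le> mean_urn_prop N a b I t \<omega>"
    unfolding mean_urn_prop_def using urn_prop_range[OF _ assms]
    by (intro divide_nonneg_nonneg sum_nonneg) auto
  moreover have "\<bar>mean_urn_prop N a b I t \<omega>\<bar> \<le> 1"
    unfolding mean_urn_prop_def using urn_prop_range[OF _ assms]
    by (intro abs_average_le) auto
  ultimately show ?thesis
    using urn_prop_range[OF j_urn assms, of t] by (simp add: dev_def)
qed

lemma abs_dev_step: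
  assumes "\<omega> \<in> space M"
  shows "\<bar>dev (Suc t) \<omega> - dev t \<omega>\<bar> \<le> 2 / real (a + b + t + 1)"
proof -
  have "mean_urn_prop N a b I (Suc t) \<omega> - mean_urn_prop N a b I t \<omega>
      = (\<Sum>i=1..N. urn_prop a b I (Suc t) i \<omega> - urn_prop a b I t i \<omega>) / real N"
    by (simp add: mean_urn_prop_def sum_subtractf diff_divide_distrib)
  then have "\<bar>mean_urn_prop N a b I (Suc t) \<omega> - mean_urn_prop N a b I t \<omega>\<bar> \<le> 1 / real (a + b + t + 1)"
    using abs_urn_prop_step[OF _ assms] by (simp only: abs_average_le)
  then show ?thesis
    using abs_urn_prop_step[OF j_urn assms, of t] unfolding dev_def by linarith
qed

lemma cond_exp_dev:
  "AE \<omega> in M. real_cond_exp M (\<F> t) (dev (Suc t)) \<omega> = (1 - \<alpha> / real (a + b + t + 1)) * dev t \<omega>"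
proof -
  interpret F: finite_measure_subalgebra M "\<F> t"
    by unfold_locales (rule subalgebra_\<F>)
  note F.real_cond_exp_diff[OF urn_prop_integrable[OF j_urn] mean_urn_prop_integrable, of "Suc t" "Suc t"]
  with cond_exp_urn_prop[OF j_urn, of t] cond_exp_mean_urn_prop[of t] show ?thesis
    unfolding dev_def[abs_def] by eventually_elim (simp add: algebra_simps)
qed

text \<open>Each step multiplies the conditional mean of the deviation by a deterministic
  factor. Dividing by the product of these factors makes it a martingale.\<close>

definition martingale :: "nat \<Rightarrow> 'a \<Rightarrow> real" where
  "martingale t \<omega> = dev t \<omega> / decay \<alpha> (a + b) t"

sublocale bounded_martingale M \<F> martingale "\<lambda>t. 1 / decay \<alpha> (a + b) t"
proof
  show "subalgebra M (\<F> n)" for n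
    by (rule subalgebra_\<F>)
  show "subalgebra (\<F> n) (\<F> s)" if "s \<le> n" for s n
    using that by (rule subalgebra_\<F>_mono)
  show "martingale n \<in> borel_measurable (\<F> n)" for n
    unfolding martingale_def[abs_def]
    by (intro borel_measurable_divide dev_measurable_\<F> borel_measurable_const)
  show "\<bar>martingale n \<omega>\<bar> \<le> 1 / decay \<alpha> (a + b) n" if "\<omega> \<in> space M" for n \<omega>
    using abs_dev_le[OF that, of n] decay_pos[OF \<alpha>_less_1, of "a + b" n]
    by (simp add: martingale_def abs_divide divide_right_mono)
  show "AE \<omega> in M. real_cond_exp M (\<F> n) (martingale (Suc n)) \<omega> = martingale n \<omega>" for n
  proof -
    interpret F: finite_measure_subalgebra M "\<F> n"
      by unfold_locales (rule subalgebra_\<F>)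
    have "integrable M (dev (Suc n))"
      unfolding dev_def[abs_def]
      by (intro Bochner_Integration.integrable_diff urn_prop_integrable mean_urn_prop_integrable j_urn)
    from F.real_cond_exp_cdiv[OF this, of "decay \<alpha> (a + b) (Suc n)"] cond_exp_dev[of n]
    show ?thesis
      unfolding martingale_def[abs_def]
    proof eventually_elim
      case (elim \<omega>)
      then show ?case
        using decay_factor_pos[OF \<alpha>_less_1, of "a + b" n] by (simp add: decay_Suc del: of_nat_add)
    qed
  qed
qed

lemma abs_martingale_step:
  assumes "\<omega> \<in> space M"
  shows "\<bar>martingale (Suc t) \<omega> - martingale t \<omega>\<bar>
           \<le> 3 / (real (a + b + t + 1) * decay \<alpha> (a + b) (Suc t))"
proof -
  define n where "n = real (a + b + t + 1)"
  have n: "0 < n" by (simp add: n_def)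
  have "martingale t \<omega> = (1 - \<alpha> / n) * dev t \<omega> / decay \<alpha> (a + b) (Suc t)"
    using decay_factor_pos[OF \<alpha>_less_1, of "a + b" t]
    by (simp add: martingale_def decay_Suc n_def del: of_nat_add)
  then have "martingale (Suc t) \<omega> - martingale t \<omega>
      = (dev (Suc t) \<omega> - dev t \<omega> + \<alpha> / n * dev t \<omega>) / decay \<alpha> (a + b) (Suc t)"
    by (simp add: martingale_def algebra_simps diff_divide_distrib add_divide_distrib)
  moreover have "\<bar>dev (Suc t) \<omega> - dev t \<omega> + \<alpha> / n * dev t \<omega>\<bar> \<le> 3 / n"
  proof -
    have "\<bar>\<alpha> / n * dev t \<omega>\<bar> \<le> 1 / n * 1"
      unfolding abs_mult using abs_dev_le[OF assms] \<alpha>_pos \<alpha>_less_1 n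
      by (intro mult_mono) (auto simp: divide_right_mono)
    moreover have "3 / n = 2 / n + 1 / n"
      by (simp add: add_divide_distrib[symmetric])
    ultimately show ?thesis
      using abs_dev_step[OF assms, of t] unfolding n_def by linarith
  qed
  then have "\<bar>dev (Suc t) \<omega> - dev t \<omega> + \<alpha> / n * dev t \<omega>\<bar> / decay \<alpha> (a + b) (Suc t)
      \<le> 3 / n / decay \<alpha> (a + b) (Suc t)"
    using decay_pos[OF \<alpha>_less_1, of "a + b" "Suc t"] by (intro divide_right_mono) auto
  ultimately show ?thesis
    using decay_pos[OF \<alpha>_less_1, of "a + b" "Suc t"] by (simp add: abs_divide n_def)
qed

text \<open>The increments are of size \<open>O(t powr (\<alpha> - 1))\<close>, since the urns move by \<open>O(1/t)\<close> and the
  normalization grows like \<open>t powr \<alpha>\<close>. Their squares are summable because \<open>\<alpha> < 1/2\<close>.\<close>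

sublocale l2_bounded_martingale M \<F> martingale "\<lambda>t. 1 / decay \<alpha> (a + b) t"
proof
  obtain K where K: "\<And>t. 1 \<le> t \<Longrightarrow> 1 / decay \<alpha> (a + b) t \<le> K * real t powr \<alpha>"
    using inverse_decay_le[OF \<alpha>_less_1] by blast
  have le: "incr_var t \<le> (3 * K)\<^sup>2 * real (Suc t) powr (2 * \<alpha> - 2)" for t
  proof -
    have step: "\<bar>martingale (Suc t) \<omega> - martingale t \<omega>\<bar> \<le> 3 * K * real (Suc t) powr (\<alpha> - 1)"
      if "\<omega> \<in> space M" for \<omega>
    proof -
      have "\<bar>martingale (Suc t) \<omega> - martingale t \<omega>\<bar>
          \<le> 3 / real (a + b + t + 1) * (1 / decay \<alpha> (a + b) (Suc t))"
        using abs_martingale_step[OF that, of t] by simp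
      also have "\<dots> \<le> 3 / real (Suc t) * (K * real (Suc t) powr \<alpha>)"
        using K[of "Suc t"] decay_pos[OF \<alpha>_less_1, of "a + b" "Suc t"]
        by (intro mult_mono divide_left_mono) auto
      also have "\<dots> = 3 * K * real (Suc t) powr (\<alpha> - 1)"
        by (simp add: powr_diff)
      finally show ?thesis .
    qed
    have "incr_var t \<le> expectation (\<lambda>\<omega>. (3 * K * real (Suc t) powr (\<alpha> - 1))\<^sup>2)"
      unfolding incr_var_def
      by (rule integral_mono[OF square_integrable])
        (use step in \<open>auto simp: abs_le_square_iff[symmetric] intro: order_trans[OF _ abs_ge_self]\<close>)
    also have "\<dots> = (3 * K)\<^sup>2 * (real (Suc t) powr (\<alpha> - 1))\<^sup>2"
      by (simp add: power_mult_distrib prob_space)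
    also have "(real (Suc t) powr (\<alpha> - 1))\<^sup>2 = real (Suc t) powr (2 * \<alpha> - 2)"
      by (simp add: power2_eq_square powr_add[symmetric])
    finally show ?thesis .
  qed
  have "summable (\<lambda>t. real t powr (2 * \<alpha> - 2))"
    using \<alpha>_less_half by (simp add: summable_real_powr_iff)
  then have "summable (\<lambda>t. (3 * K)\<^sup>2 * real (Suc t) powr (2 * \<alpha> - 2))"
    by (intro summable_mult) (subst summable_Suc_iff)
  then show "summable incr_var"
    by (rule summable_comparison_test') (use le incr_var_nonneg in auto)
qed

lemma cond_prob_first_draw:
  assumes "i \<in> {1..N}"
  shows "AE \<omega> in M. cond_prob_subalg M (\<F> 0) (I 1 i -` {1} \<inter> space M) \<omega> = real a / real (a + b)"
proof -
  have "mean_urn_prop N a b I 0 \<omega> = real a / real (a + b)" for \<omega>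
    using N_gt_1 by (simp add: mean_urn_prop_def urn_prop_0)
  moreover have "I 1 i -` {1} \<inter> space M = {\<omega> \<in> space M. I (0 + 1) i \<omega> = 1}"
    by auto
  moreover have "\<alpha> * x + (1 - \<alpha>) * x = x" for x
    by (simp add: algebra_simps)
  ultimately show ?thesis
    using I_cond_prob[OF assms, of 0] by (simp only: urn_prop_0)
qed

text \<open>With \<open>p = a/(a+b)\<close>, the first draw is red in urn \<open>j\<close> and black in another given urn with
  probability \<open>p - p\<^sup>2 > 0\<close>, and then urn \<open>j\<close> is above average.\<close>

lemma prob_dev_1_pos: "0 < prob {\<omega> \<in> space M. dev 1 \<omega> \<noteq> 0}"
proof -
  define p where "p = real a / real (a + b)"
  have p: "0 < p" "p < 1"
    using a_pos b_pos by (auto simp: p_def)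
  obtain i where i: "i \<in> {1..N}" "i \<noteq> j"
  proof (cases "j = 1")
    case True
    then show ?thesis using N_gt_1 that[of 2] by auto
  next
    case False
    then show ?thesis using N_gt_1 that[of 1] by auto
  qed
  have meas [measurable]: "I 1 k \<in> borel_measurable M" if "k \<in> {1..N}" for k
    using that by (intro I_measurable) auto
  define R where "R k = I 1 k -` {1} \<inter> space M" for k
  have R: "R k \<in> sets M" if "k \<in> {1..N}" for k
    unfolding R_def by (rule measurable_sets[OF meas[OF that]]) simp
  have "prob (R j) = p"
    using prob_eq_of_cond_prob[OF R[OF j_urn]] cond_prob_first_draw[OF j_urn] by (simp add: R_def p_def)
  moreover have "prob (R i \<inter> R j) = p * p"
  proof (rule prob_eq_of_cond_prob)
    show "R i \<inter> R j \<in> sets M"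
      using R i j_urn by auto
    have "AE \<omega> in M. cond_prob_subalg M (\<F> 0) (\<Inter>k\<in>{i, j}. I 1 k -` {1} \<inter> space M) \<omega>
        = (\<Prod>k\<in>{i, j}. cond_prob_subalg M (\<F> 0) (I 1 k -` {1} \<inter> space M) \<omega>)"
    proof -
      have "\<forall>J\<subseteq>{1..N}. J \<noteq> {} \<longrightarrow> finite J \<longrightarrow> (\<forall>A\<in>(\<Pi> k\<in>J. sets borel).
          AE \<omega> in M. cond_prob_subalg M (\<F> 0) (\<Inter>k\<in>J. I 1 k -` A k \<inter> space M) \<omega>
            = (\<Prod>k\<in>J. cond_prob_subalg M (\<F> 0) (I 1 k -` A k \<inter> space M) \<omega>))"
        using I_cond_indep[of 0] unfolding cond_indep_vars_def by simp
      from this[rule_format, of "{i, j}" "\<lambda>_. {1}"] i j_urn show ?thesis by simp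
    qed
    then show "AE \<omega> in M. cond_prob_subalg M (\<F> 0) (R i \<inter> R j) \<omega> = p * p"
      using cond_prob_first_draw[OF i(1)] cond_prob_first_draw[OF j_urn]
    proof eventually_elim
      case (elim \<omega>)
      then show ?case using i(2) by (simp add: R_def p_def)
    qed
  qed
  moreover have "prob (R j - R i) = prob (R j) - prob (R i \<inter> R j)"
    using R i j_urn by (subst finite_measure_Diff') (auto simp: Int_commute)
  moreover have "p * p < p"
    using p by simp
  ultimately have "0 < prob (R j - R i)" by simp
  also have "\<dots> \<le> prob {\<omega> \<in> space M. dev 1 \<omega> \<noteq> 0}"
  proof (rule finite_measure_mono)
    have [measurable]: "dev 1 \<in> borel_measurable M"
      by (rule measurable_from_subalg[OF subalgebra_\<F> dev_measurable_\<F>])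
    show "{\<omega> \<in> space M. dev 1 \<omega> \<noteq> 0} \<in> sets M" by measurable
    show "R j - R i \<subseteq> {\<omega> \<in> space M. dev 1 \<omega> \<noteq> 0}"
    proof
      fix \<omega> assume "\<omega> \<in> R j - R i"
      then have \<omega>: "\<omega> \<in> space M" "I 1 j \<omega> = 1" "I 1 i \<omega> = 0"
        using I_values[of 1 i \<omega>] i(1) by (auto simp: R_def)
      have I: "I 1 k \<omega> \<le> 1" if "k \<in> {1..N}" for k
        using I_values[of 1 k \<omega>] that \<omega>(1) by auto
      have "(\<Sum>k=1..N. I 1 k \<omega>) < (\<Sum>k=1..N. 1)"
        using i(1) \<omega>(3) by (intro sum_strict_mono_strong[of _ i] I) auto
      then have less: "(\<Sum>k=1..N. I 1 k \<omega>) < real N" by simp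
      define S where "S = (\<Sum>k=1..N. I 1 k \<omega>)"
      define n where "n = real (a + b + 1)"
      have n: "0 < n" by (simp add: n_def)
      have "dev 1 \<omega> = (real a + 1) / n - (real N * real a + S) / n / real N"
        unfolding S_def n_def using \<omega>(2)
        by (simp add: dev_def mean_urn_prop_def urn_prop_def sum.distrib flip: sum_divide_distrib)
      then have "real N * dev 1 \<omega> = (real N - S) / n"
        using N_gt_1 n by (simp add: right_diff_distrib distrib_left diff_divide_distrib add_divide_distrib)
      also have "\<dots> > 0"
        using less n by (simp add: S_def)
      finally show "\<omega> \<in> {\<omega> \<in> space M. dev 1 \<omega> \<noteq> 0}"
        using \<omega>(1) by auto
    qed
  qed
  finally show ?thesis .
qed

lemma lim_not_AE_zero: "\<not> (AE \<omega> in M. Y_lim \<omega> = 0)"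
proof
  assume "AE \<omega> in M. Y_lim \<omega> = 0"
  then have "incr_var 0 = 0"
    by (intro lim_eq_initial_imp_incr_var_0) (simp add: martingale_def dev_0)
  then have "AE \<omega> in M. (martingale (Suc 0) \<omega> - martingale 0 \<omega>)\<^sup>2 = 0"
    unfolding incr_var_def
    by (subst (asm) integral_nonneg_eq_0_iff_AE[OF square_integrable]) auto
  then have "AE \<omega> in M. dev 1 \<omega> = 0"
    using decay_pos[OF \<alpha>_less_1, of "a + b" "Suc 0"] by (simp add: martingale_def dev_0)
  then have "prob {\<omega> \<in> space M. dev 1 \<omega> \<noteq> 0} = 0"
    by (intro prob_eq_0_AE) (auto elim: AE_mp)
  with prob_dev_1_pos show False by simp
qed

end

theorem theorem3p5:
  fixes M :: "'a measure" and N a b j :: nat and \<alpha> :: real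
    and I :: "nat \<Rightarrow> nat \<Rightarrow> 'a \<Rightarrow> real"
  assumes "interacting_urns M N a b \<alpha> I"
    and "N > 1" and "a \<ge> 1" and "b \<ge> 1"
    and "0 < \<alpha>" and "\<alpha> < 1 / 2"
    and "j \<in> {1..N}"
  shows "\<exists>D \<in> borel_measurable M.
    measure M {\<omega> \<in> space M. D \<omega> \<noteq> 0} > 0 \<and>
    (AE \<omega> in M. (\<lambda>t. real t powr \<alpha> * (urn_prop a b I t j \<omega> - mean_urn_prop N a b I t \<omega>))
        \<longlonglongrightarrow> D \<omega>) \<and>
    converges_L1 M
      (\<lambda>t \<omega>. real t powr \<alpha> * (urn_prop a b I t j \<omega> - mean_urn_prop N a b I t \<omega>)) D"
proof -
  interpret interacting_urns M N a b \<alpha> I by fact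
  interpret tagged_urn M N a b \<alpha> I j
    by unfold_locales (use assms in auto)
  define \<rho> where "\<rho> t = real t powr \<alpha> * decay \<alpha> (a + b) t" for t
  define L where "L = Gamma (real (a + b) + 1) / Gamma (real (a + b) + 1 - \<alpha>)"
  have \<rho>: "\<rho> \<longlonglongrightarrow> L"
    unfolding \<rho>_def L_def by (rule powr_decay_tendsto[OF \<alpha>_less_1])
  have "0 < L"
    unfolding L_def using \<alpha>_less_1 by (intro divide_pos_pos Gamma_real_pos) auto
  have eq: "real t powr \<alpha> * (urn_prop a b I t j \<omega> - mean_urn_prop N a b I t \<omega>) = \<rho> t * martingale t \<omega>" for t \<omega>
    using decay_pos[OF \<alpha>_less_1, of "a + b" t] by (simp add: \<rho>_def martingale_def dev_def)
  show ?thesis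
    unfolding eq
  proof (intro bexI[of _ "\<lambda>\<omega>. L * Y_lim \<omega>"] conjI)
    have "\<not> measure M {\<omega> \<in> space M. L * Y_lim \<omega> \<noteq> 0} = 0"
    proof
      assume "measure M {\<omega> \<in> space M. L * Y_lim \<omega> \<noteq> 0} = 0"
      then have "AE \<omega> in M. \<not> (L * Y_lim \<omega> \<noteq> 0)"
        by (subst (asm) prob_eq_0) (auto elim: AE_mp)
      then have "AE \<omega> in M. Y_lim \<omega> = 0"
        using \<open>0 < L\<close> by simp
      with lim_not_AE_zero show False ..
    qed
    then show "0 < measure M {\<omega> \<in> space M. L * Y_lim \<omega> \<noteq> 0}"
      by (simp add: zero_less_measure_iff)
    show "AE \<omega> in M. (\<lambda>t. \<rho> t * martingale t \<omega>) \<longlonglongrightarrow> L * Y_lim \<omega>"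
      using AE_convergent by eventually_elim (intro tendsto_mult \<rho>)
    show "converges_L1 M (\<lambda>t \<omega>. \<rho> t * martingale t \<omega>) (\<lambda>\<omega>. L * Y_lim \<omega>)"
      by (rule converges_L1_scale[OF L1_convergent \<rho>])
  qed measurable
qed

end
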